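(* Let $h_{PSF}=[h_{i_1,i_2}]_{i_1=-q_1,\ldots,q_1,\ i_2=-q_2,\ldots,q_2}$ be a generic (not necessarily symmetric) two-dimensional PSF and let $A=A(h)\in\mathbb{R}^{n_1n_2\times n_1n_2}$ be the Anti-Reflective matrix generated by $h_{PSF}$, with $n=(n_1,n_2)$. Then the optimal preconditioner of $A$ in the algebra $\mathcal{AR}_n^{2D}$, i.e. $$P^*=\underset{P\in\mathcal{AR}_n^{2D}}{\arg\min}\ \|A-P\|_{\mathcal F}^2,$$ is the Anti-Reflective matrix $A(s)$ generated by the symmetrized PSF $s_{PSF}=[s_{i_1,i_2}]_{i_1=-q_1,\ldots,q_1,\ i_2=-q_2,\ldots,q_2}$, where $$s_{\pm i_1,\pm i_2}=\frac{h_{-i_1,-i_2}+h_{-i_1,i_2}+h_{i_1,-i_2}+h_{i_1,i_2}}{4}.$$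
   Context: A two-dimensional mask is a real array $[h_{i_1,i_2}]_{i_1=-q_1,\ldots,q_1,\ i_2=-q_2,\ldots,q_2}$; it is called a PSF (point spread function) if $h_{i_1,i_2}\ge 0$ for all $i_1,i_2$ and $\sum_{i_1,i_2}h_{i_1,i_2}=1$. Standing assumption on the support: $q_j\le n_j-3$ for $j=1,2$ (i.e. $h_{i_1,i_2}=0$ if $|i_j|\ge n_j-2$ for some $j\in\{1,2\}$), where $n_1,n_2\ge 3$ are the image sizes. Anti-Reflective matrix: given a two-dimensional mask, i.e. a real array $h=[h_{i_1,i_2}]_{i_1=-q_1,\ldots,q_1,\ i_2=-q_2,\ldots,q_2}$, with $q_j\le n_j-3$ for $j=1,2$, $A(h)\in\mathbb{R}^{n_1n_2\times n_1n_2}$ is the matrix (with respect to the row-wise ordering of the index pairs) of the linear map $f=[f_{i_1,i_2}]\mapsto g=[g_{i_1,i_2}]$, $i_1=1,\ldots,n_1$, $i_2=1,\ldots,n_2$, given by $$g_{i_1,i_2}=\sum_{s_1=-q_1}^{q_1}\sum_{s_2=-q_2}^{q_2}h_{s_1,s_2}f_{i_1-s_1,i_2-s_2},$$ where the values of $f$ with index pairs outside $\{1,\ldots,n_1\}\times\{1,\ldots,n_2\}$ are defined by the Anti-Reflective boundary conditions. Along the borders: $$f_{1-i_1,i_2}=2f_{1,i_2}-f_{i_1+1,i_2},\quad f_{n_1+i_1,i_2}=2f_{n_1,i_2}-f_{n_1-i_1,i_2},\quad i_1=1,\ldots,q_1,\ i_2=1,\ldots,n_2,$$ $$f_{i_1,1-i_2}=2f_{i_1,1}-f_{i_1,i_2+1},\quad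 f_{i_1,n_2+i_2}=2f_{i_1,n_2}-f_{i_1,n_2-i_2},\quad i_1=1,\ldots,n_1,\ i_2=1,\ldots,q_2.$$ At the corners (double anti-reflection, first with respect to one axis and then with respect to the other), for $i_1=1,\ldots,q_1$, $i_2=1,\ldots,q_2$: $$f_{1-i_1,1-i_2}=4f_{1,1}-2f_{1,i_2+1}-2f_{i_1+1,1}+f_{i_1+1,i_2+1},$$ $$f_{1-i_1,n_2+i_2}=4f_{1,n_2}-2f_{1,n_2-i_2}-2f_{i_1+1,n_2}+f_{i_1+1,n_2-i_2},$$ $$f_{n_1+i_1,1-i_2}=4f_{n_1,1}-2f_{n_1,i_2+1}-2f_{n_1-i_1,1}+f_{n_1-i_1,i_2+1},$$ $$f_{n_1+i_1,n_2+i_2}=4f_{n_1,n_2}-2f_{n_1,n_2-i_2}-2f_{n_1-i_1,n_2}+f_{n_1-i_1,n_2-i_2}.$$ A mask $s$ is strongly symmetric if it is symmetric with respect to each direction, i.e. $s_{i_1,i_2}=s_{|i_1|,|i_2|}$ for all $i_1,i_2$. The algebra $\mathcal{AR}_n^{2D}$ is the set of all Anti-Reflective matrices $A(s)\in\mathbb{R}^{n_1n_2\times n_1n_2}$ generated by strongly symmetric real masks $s=[s_{i_1,i_2}]_{i_1=-q_1',\ldots,q_1',\ i_2=-q_2',\ldots,q_2'}$ with $q_j'\le n_j-3$, $j=1,2$ (no sign or normalization condition is imposed on these masks). $\|\cdot\|_{\mathcal F}$ is the Frobenius norm, $\|A\|_{\mathcal F}=\sqrt{\sum_{i,j}|a_{i,j}|^2}$.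 *)

theory Defs
  imports Complex_Main "Jordan_Normal_Form.Matrix"
begin

text \<open>
  A mask with half-widths \<open>q1\<close>, \<open>q2\<close> is a function on pairs of integers of which only the
  values on \<open>{-q1..q1} \<times> {-q2..q2}\<close> are ever used.  Likewise an image of size \<open>n1 \<times> n2\<close> is a
  function of which only the values on \<open>{1..n1} \<times> {1..n2}\<close> are used.
\<close>

definition is_psf :: "nat \<Rightarrow> nat \<Rightarrow> (int \<Rightarrow> int \<Rightarrow> real) \<Rightarrow> bool" where
  "is_psf q1 q2 h \<longleftrightarrow>
     (\<forall>i1\<in>{- int q1..int q1}. \<forall>i2\<in>{- int q2..int q2}. h i1 i2 \<ge> 0) \<and>
     (\<Sum>i1 = - int q1..int q1. \<Sum>i2 = - int q2..int q2. h i1 i2) = 1"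

definition strongly_symmetric :: "nat \<Rightarrow> nat \<Rightarrow> (int \<Rightarrow> int \<Rightarrow> real) \<Rightarrow> bool" where
  "strongly_symmetric q1 q2 s \<longleftrightarrow>
     (\<forall>i1\<in>{- int q1..int q1}. \<forall>i2\<in>{- int q2..int q2}. s i1 i2 = s \<bar>i1\<bar> \<bar>i2\<bar>)"

definition symmetrized :: "(int \<Rightarrow> int \<Rightarrow> real) \<Rightarrow> int \<Rightarrow> int \<Rightarrow> real" where
  "symmetrized h i1 i2 = (h (- i1) (- i2) + h (- i1) i2 + h i1 (- i2) + h i1 i2) / 4"

text \<open>
  Extension of an image by Anti-Reflective boundary conditions, indexed by the actual position
  \<open>(j1, j2)\<close>: a position \<open>j1 < 1\<close> is \<open>1 - i1\<close> with \<open>i1 + 1 = 2 - j1\<close>, and a position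
  \<open>j1 > n1\<close> is \<open>n1 + i1\<close> with \<open>n1 - i1 = 2 * n1 - j1\<close>.
\<close>

definition ar_extend :: "nat \<Rightarrow> nat \<Rightarrow> (int \<Rightarrow> int \<Rightarrow> real) \<Rightarrow> int \<Rightarrow> int \<Rightarrow> real" where
  "ar_extend n1 n2 f j1 j2 =
    (let m1 = int n1; m2 = int n2 in
     if j1 < 1 then
       (if j2 < 1 then
          4 * f 1 1 - 2 * f 1 (2 - j2) - 2 * f (2 - j1) 1 + f (2 - j1) (2 - j2)
        else if j2 \<le> m2 then
          2 * f 1 j2 - f (2 - j1) j2
        else
          4 * f 1 m2 - 2 * f 1 (2 * m2 - j2) - 2 * f (2 - j1) m2 + f (2 - j1) (2 * m2 - j2))
     else if j1 \<le> m1 then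
       (if j2 < 1 then
          2 * f j1 1 - f j1 (2 - j2)
        else if j2 \<le> m2 then
          f j1 j2
        else
          2 * f j1 m2 - f j1 (2 * m2 - j2))
     else
       (if j2 < 1 then
          4 * f m1 1 - 2 * f m1 (2 - j2) - 2 * f (2 * m1 - j1) 1 + f (2 * m1 - j1) (2 - j2)
        else if j2 \<le> m2 then
          2 * f m1 j2 - f (2 * m1 - j1) j2
        else
          4 * f m1 m2 - 2 * f m1 (2 * m2 - j2) - 2 * f (2 * m1 - j1) m2
            + f (2 * m1 - j1) (2 * m2 - j2)))"

lemma ar_extend_inside:
  assumes "1 \<le> j1" "j1 \<le> int n1" "1 \<le> j2" "j2 \<le> int n2"
  shows "ar_extend n1 n2 f j1 j2 = f j1 j2"
  using assms by (simp add: ar_extend_def)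

lemma ar_extend_borders:
  assumes "n1 \<ge> 1" "n2 \<ge> 1"
  shows
    "\<lbrakk>1 \<le> i1; 1 \<le> i2; i2 \<le> int n2\<rbrakk> \<Longrightarrow>
       ar_extend n1 n2 f (1 - i1) i2 = 2 * f 1 i2 - f (i1 + 1) i2"
    "\<lbrakk>1 \<le> i1; 1 \<le> i2; i2 \<le> int n2\<rbrakk> \<Longrightarrow>
       ar_extend n1 n2 f (int n1 + i1) i2 = 2 * f (int n1) i2 - f (int n1 - i1) i2"
    "\<lbrakk>1 \<le> i1; i1 \<le> int n1; 1 \<le> i2\<rbrakk> \<Longrightarrow>
       ar_extend n1 n2 f i1 (1 - i2) = 2 * f i1 1 - f i1 (i2 + 1)"
    "\<lbrakk>1 \<le> i1; i1 \<le> int n1; 1 \<le> i2\<rbrakk> \<Longrightarrow>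
       ar_extend n1 n2 f i1 (int n2 + i2) = 2 * f i1 (int n2) - f i1 (int n2 - i2)"
  using assms by (auto simp: ar_extend_def Let_def add.commute)

lemma ar_extend_corners:
  assumes "n1 \<ge> 1" "n2 \<ge> 1" "1 \<le> i1" "1 \<le> i2"
  shows
    "ar_extend n1 n2 f (1 - i1) (1 - i2) =
       4 * f 1 1 - 2 * f 1 (i2 + 1) - 2 * f (i1 + 1) 1 + f (i1 + 1) (i2 + 1)"
    "ar_extend n1 n2 f (1 - i1) (int n2 + i2) =
       4 * f 1 (int n2) - 2 * f 1 (int n2 - i2) - 2 * f (i1 + 1) (int n2)
         + f (i1 + 1) (int n2 - i2)"
    "ar_extend n1 n2 f (int n1 + i1) (1 - i2) =
       4 * f (int n1) 1 - 2 * f (int n1) (i2 + 1) - 2 * f (int n1 - i1) 1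
         + f (int n1 - i1) (i2 + 1)"
    "ar_extend n1 n2 f (int n1 + i1) (int n2 + i2) =
       4 * f (int n1) (int n2) - 2 * f (int n1) (int n2 - i2) - 2 * f (int n1 - i1) (int n2)
         + f (int n1 - i1) (int n2 - i2)"
  using assms by (auto simp: ar_extend_def Let_def add.commute)

definition ar_blur ::
  "nat \<Rightarrow> nat \<Rightarrow> nat \<Rightarrow> nat \<Rightarrow> (int \<Rightarrow> int \<Rightarrow> real) \<Rightarrow> (int \<Rightarrow> int \<Rightarrow> real) \<Rightarrow> int \<Rightarrow> int \<Rightarrow> real"
where
  "ar_blur n1 n2 q1 q2 h f i1 i2 =
     (\<Sum>s1 = - int q1..int q1. \<Sum>s2 = - int q2..int q2.
        h s1 s2 * ar_extend n1 n2 f (i1 - s1) (i2 - s2))"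

text \<open>Row-wise ordering: the 0-based position \<open>k < n1 * n2\<close> holds the pixel
  \<open>(k div n2 + 1, k mod n2 + 1)\<close>.\<close>

definition vec_of_image :: "nat \<Rightarrow> nat \<Rightarrow> (int \<Rightarrow> int \<Rightarrow> real) \<Rightarrow> real vec" where
  "vec_of_image n1 n2 f = vec (n1 * n2) (\<lambda>k. f (int (k div n2) + 1) (int (k mod n2) + 1))"

definition unit_image :: "nat \<Rightarrow> nat \<Rightarrow> int \<Rightarrow> int \<Rightarrow> real" where
  "unit_image n2 k i1 i2 =
     (if i1 = int (k div n2) + 1 \<and> i2 = int (k mod n2) + 1 then 1 else 0)"

text \<open>Column \<open>c\<close> is the image of the \<open>c\<close>-th unit vector; \<open>ar_matrix_mult_vec\<close> below shows that
  this is the matrix of the blurring map.\<close>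

definition ar_matrix ::
  "nat \<Rightarrow> nat \<Rightarrow> nat \<Rightarrow> nat \<Rightarrow> (int \<Rightarrow> int \<Rightarrow> real) \<Rightarrow> real mat" where
  "ar_matrix n1 n2 q1 q2 h =
     mat (n1 * n2) (n1 * n2)
       (\<lambda>(r, c). vec_of_image n1 n2 (ar_blur n1 n2 q1 q2 h (unit_image n2 c)) $ r)"

definition ar_algebra :: "nat \<Rightarrow> nat \<Rightarrow> real mat set" where
  "ar_algebra n1 n2 =
     {ar_matrix n1 n2 q1 q2 s | q1 q2 s.
        q1 \<le> n1 - 3 \<and> q2 \<le> n2 - 3 \<and> strongly_symmetric q1 q2 s}"

definition frobenius_norm :: "real mat \<Rightarrow> real" where
  "frobenius_norm A = sqrt (\<Sum>i<dim_row A. \<Sum>j<dim_col A. \<bar>A $$ (i, j)\<bar>\<^sup>2)"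

lemma ar_extend_sum:
  assumes "finite C"
  shows "ar_extend n1 n2 (\<lambda>i1 i2. \<Sum>c\<in>C. a c * u c i1 i2) j1 j2 =
    (\<Sum>c\<in>C. a c * ar_extend n1 n2 (u c) j1 j2)"
  using assms
  by (induction C rule: finite_induct)
     (simp_all add: ar_extend_def Let_def algebra_simps split del: if_split split: if_splits)

lemma ar_extend_cong:
  assumes "\<And>i1 i2. \<lbrakk>1 \<le> i1; i1 \<le> int n1; 1 \<le> i2; i2 \<le> int n2\<rbrakk> \<Longrightarrow> f i1 i2 = g i1 i2"
    and "3 \<le> n1" "3 \<le> n2"
    and "2 - int n1 \<le> j1" "j1 \<le> 2 * int n1 - 1" "2 - int n2 \<le> j2" "j2 \<le> 2 * int n2 - 1"
  shows "ar_extend n1 n2 f j1 j2 = ar_extend n1 n2 g j1 j2"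
  using assms by (simp add: ar_extend_def Let_def)

lemma image_eq_sum_unit_images:
  assumes "1 \<le> i1" "i1 \<le> int n1" "1 \<le> i2" "i2 \<le> int n2"
  shows "f i1 i2 = (\<Sum>c<n1 * n2. vec_of_image n1 n2 f $ c * unit_image n2 c i1 i2)"
proof -
  define a b where "a = nat (i1 - 1)" and "b = nat (i2 - 1)"
  have ab: "i1 = int a + 1" "i2 = int b + 1" "a < n1" "b < n2"
    using assms by (auto simp: a_def b_def)
  define k where "k = a * n2 + b"
  have "k < n2 + a * n2" using ab by (simp add: k_def)
  also have "\<dots> = Suc a * n2" by simp
  also have "\<dots> \<le> n1 * n2" using ab by (intro mult_le_mono1) simp
  finally have k: "k < n1 * n2" .
  have kd: "k div n2 = a" "k mod n2 = b" using ab by (simp_all add: k_def)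
  have eq: "unit_image n2 c i1 i2 = (if c = k then 1 else 0)" for c
    using kd div_mult_mod_eq[of c n2] by (auto simp: unit_image_def ab k_def)
  have "(\<Sum>c<n1 * n2. vec_of_image n1 n2 f $ c * unit_image n2 c i1 i2) =
    (\<Sum>c<n1 * n2. if c = k then vec_of_image n1 n2 f $ c else 0)"
    by (intro sum.cong refl) (simp add: eq)
  also have "\<dots> = vec_of_image n1 n2 f $ k" using k by simp
  also have "\<dots> = f i1 i2" using k by (simp add: vec_of_image_def kd ab)
  finally show ?thesis by simp
qed

lemma ar_matrix_mult_vec:
  assumes "3 \<le> n1" "3 \<le> n2" "q1 \<le> n1 - 3" "q2 \<le> n2 - 3"
  shows "ar_matrix n1 n2 q1 q2 h *\<^sub>v vec_of_image n1 n2 f =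
    vec_of_image n1 n2 (ar_blur n1 n2 q1 q2 h f)"
proof (rule eq_vecI)
  show "dim_vec (ar_matrix n1 n2 q1 q2 h *\<^sub>v vec_of_image n1 n2 f) =
    dim_vec (vec_of_image n1 n2 (ar_blur n1 n2 q1 q2 h f))"
    by (simp add: ar_matrix_def vec_of_image_def)
next
  fix r assume "r < dim_vec (vec_of_image n1 n2 (ar_blur n1 n2 q1 q2 h f))"
  then have r: "r < n1 * n2" by (simp add: vec_of_image_def)
  define x y where "x = int (r div n2) + 1" and "y = int (r mod n2) + 1"
  have "r div n2 < n1" using r by (simp add: less_mult_imp_div_less)
  moreover have "r mod n2 < n2" using assms by simp
  ultimately have xy: "1 \<le> x" "x \<le> int n1" "1 \<le> y" "y \<le> int n2"
    by (simp_all add: x_def y_def)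
  let ?v = "\<lambda>c. vec_of_image n1 n2 f $ c"
  have ext: "ar_extend n1 n2 f (x - s1) (y - s2) =
      (\<Sum>c<n1 * n2. ?v c * ar_extend n1 n2 (unit_image n2 c) (x - s1) (y - s2))"
    if "s1 \<in> {- int q1..int q1}" "s2 \<in> {- int q2..int q2}" for s1 s2
  proof -
    have "ar_extend n1 n2 f (x - s1) (y - s2) =
      ar_extend n1 n2 (\<lambda>i1 i2. \<Sum>c<n1 * n2. ?v c * unit_image n2 c i1 i2) (x - s1) (y - s2)"
      by (rule ar_extend_cong)
         (use that assms xy in \<open>auto intro!: image_eq_sum_unit_images\<close>)
    then show ?thesis by (simp add: ar_extend_sum)
  qed
  have "vec_of_image n1 n2 (ar_blur n1 n2 q1 q2 h f) $ r = ar_blur n1 n2 q1 q2 h f x y"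
    using r by (simp add: vec_of_image_def x_def y_def)
  also have "\<dots> = (\<Sum>s1 = - int q1..int q1. \<Sum>s2 = - int q2..int q2. \<Sum>c<n1 * n2.
      h s1 s2 * (?v c * ar_extend n1 n2 (unit_image n2 c) (x - s1) (y - s2)))"
    unfolding ar_blur_def by (intro sum.cong refl) (simp add: ext sum_distrib_left)
  also have "\<dots> = (\<Sum>s1 = - int q1..int q1. \<Sum>c<n1 * n2. \<Sum>s2 = - int q2..int q2.
      h s1 s2 * (?v c * ar_extend n1 n2 (unit_image n2 c) (x - s1) (y - s2)))"
    by (intro sum.cong refl sum.swap)
  also have "\<dots> = (\<Sum>c<n1 * n2. \<Sum>s1 = - int q1..int q1. \<Sum>s2 = - int q2..int q2.
      h s1 s2 * (?v c * ar_extend n1 n2 (unit_image n2 c) (x - s1) (y - s2)))"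
    by (rule sum.swap)
  also have "\<dots> = (\<Sum>c<n1 * n2. ar_blur n1 n2 q1 q2 h (unit_image n2 c) x y * ?v c)"
    by (simp add: ar_blur_def sum_distrib_left sum_distrib_right mult_ac)
  also have "\<dots> = (ar_matrix n1 n2 q1 q2 h *\<^sub>v vec_of_image n1 n2 f) $ r"
    using r by (simp add: ar_matrix_def scalar_prod_def vec_of_image_def x_def y_def
        lessThan_atLeast0)
  finally show "(ar_matrix n1 n2 q1 q2 h *\<^sub>v vec_of_image n1 n2 f) $ r =
      vec_of_image n1 n2 (ar_blur n1 n2 q1 q2 h f) $ r" by simp
qed

lemma strongly_symmetric_symmetrized: "strongly_symmetric q1 q2 (symmetrized h)"
  by (auto simp: strongly_symmetric_def symmetrized_def abs_if)

lemma is_psf_symmetrized: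
  assumes "is_psf q1 q2 h"
  shows "is_psf q1 q2 (symmetrized h)"
proof -
  let ?S = "\<lambda>g. (\<Sum>i1 = - int q1..int q1. \<Sum>i2 = - int q2..int q2. g i1 i2 :: real)"
  have neg: "(\<Sum>i = - int q..int q. g (- i)) = (\<Sum>i = - int q..int q. g i)"
    for q and g :: "int \<Rightarrow> real"
    by (rule sum.reindex_bij_witness[of _ uminus uminus]) auto
  have "?S (\<lambda>i1 i2. h (- i1) i2) = ?S h"
    using neg[of "\<lambda>i1. \<Sum>i2 = - int q2..int q2. h i1 i2" q1] by simp
  moreover have "?S (\<lambda>i1 i2. h i1 (- i2)) = ?S h"
    by (simp add: neg)
  moreover have "?S (\<lambda>i1 i2. h (- i1) (- i2)) = ?S h"
    using neg[of "\<lambda>i1. \<Sum>i2 = - int q2..int q2. h i1 i2" q1] by (simp add: neg)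
  ultimately have "?S (symmetrized h) = ?S h"
    by (simp add: symmetrized_def sum.distrib flip: sum_divide_distrib)
  then show ?thesis
    using assms by (auto simp: is_psf_def symmetrized_def intro!: add_nonneg_nonneg)
qed

end

theory Submission
  imports Defs
begin

text \<open>
  Reversing an image along either axis commutes with the Anti-Reflective extension, so reflecting
  the mask along an axis conjugates \<open>A(h)\<close> by the permutation matrix of that reversal.  Strongly
  symmetric masks give matrices fixed by these conjugations, and conjugation by a permutation
  preserves the Frobenius inner product.  Hence \<open>A(h)\<close>, its reflected versions, and their average
  \<open>A(s)\<close> all have the same inner product with each member of the algebra: \<open>A(s)\<close> is the orthogonal
  projection of \<open>A(h)\<close>, and Pythagoras gives both minimality and uniqueness.
\<close>

text \<open>The optional reflection \<open>x \<mapsto> m - x\<close>, with \<open>m = 0\<close> for mask offsets, \<open>m = n + 1\<close> for pixel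
  coordinates and \<open>m = n - 1\<close> for 0-based row and column numbers.\<close>

definition mirror :: "bool \<Rightarrow> 'a::minus \<Rightarrow> 'a \<Rightarrow> 'a" where
  "mirror b m x = (if b then m - x else x)"

definition mirror_mask :: "bool \<Rightarrow> bool \<Rightarrow> (int \<Rightarrow> int \<Rightarrow> real) \<Rightarrow> int \<Rightarrow> int \<Rightarrow> real" where
  "mirror_mask b1 b2 h s1 s2 = h (mirror b1 0 s1) (mirror b2 0 s2)"

definition mirror_image ::
  "nat \<Rightarrow> nat \<Rightarrow> bool \<Rightarrow> bool \<Rightarrow> (int \<Rightarrow> int \<Rightarrow> real) \<Rightarrow> int \<Rightarrow> int \<Rightarrow> real" where
  "mirror_image n1 n2 b1 b2 f i1 i2 = f (mirror b1 (int n1 + 1) i1) (mirror b2 (int n2 + 1) i2)"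

definition mirror_index :: "nat \<Rightarrow> nat \<Rightarrow> bool \<Rightarrow> bool \<Rightarrow> nat \<Rightarrow> nat" where
  "mirror_index n1 n2 b1 b2 k = mirror b1 (n1 - 1) (k div n2) * n2 + mirror b2 (n2 - 1) (k mod n2)"

section \<open>Reflection of the boundary extension and of the blur\<close>

definition ar_extend1 :: "nat \<Rightarrow> (int \<Rightarrow> real) \<Rightarrow> int \<Rightarrow> real" where
  "ar_extend1 n g j =
    (if j < 1 then 2 * g 1 - g (2 - j)
     else if j \<le> int n then g j
     else 2 * g (int n) - g (2 * int n - j))"

text \<open>Expanding one anti-reflection inside the other yields the corner formulas, so each axis
  can be treated by itself.\<close>

lemma ar_extend_separable:
  "ar_extend n1 n2 f j1 j2 = ar_extend1 n1 (\<lambda>i1. ar_extend1 n2 (f i1) j2) j1"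
  by (simp add: ar_extend_def ar_extend1_def Let_def)

text \<open>Reflection swaps the two outer branches: for \<open>j < 1\<close> the position
  \<open>n + 1 - j\<close> exceeds \<open>n\<close>, and \<open>2 * n - (n + 1 - j)\<close> is the
  reflection of \<open>2 - j\<close>.\<close>

lemma ar_extend1_mirror:
  assumes "1 \<le> n"
  shows "ar_extend1 n (\<lambda>i. g (mirror b (int n + 1) i)) j = ar_extend1 n g (mirror b (int n + 1) j)"
proof -
  consider "j < 1" | "1 \<le> j" "j \<le> int n" | "int n < j" by linarith
  then show ?thesis
    using assms by cases (auto simp: ar_extend1_def mirror_def algebra_simps)
qed

lemma ar_extend_mirror:
  assumes "1 \<le> n1" "1 \<le> n2"
  shows "ar_extend n1 n2 (mirror_image n1 n2 b1 b2 f) j1 j2 =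
    ar_extend n1 n2 f (mirror b1 (int n1 + 1) j1) (mirror b2 (int n2 + 1) j2)"
  unfolding ar_extend_separable mirror_image_def
  \<comment> \<open>For the first axis, \<open>g\<close> is the image already extended to a fixed
    second coordinate \<open>j\<close>.\<close>
  by (simp add: ar_extend1_mirror[OF assms(2)]
      ar_extend1_mirror[OF assms(1), where g = "\<lambda>i. ar_extend1 n2 (f i) j" for j])

lemma sum_mirror:
  fixes g :: "int \<Rightarrow> 'a::comm_monoid_add"
  shows "(\<Sum>s = - int q..int q. g (mirror b 0 s)) = (\<Sum>s = - int q..int q. g s)"
  by (rule sum.reindex_bij_witness[of _ "mirror b 0" "mirror b 0"]) (auto simp: mirror_def)

text \<open>Positions reflect about the image centre and offsets about zero, so differences
  \<open>i - s\<close> reflect consistently; sign changes of the offsets permute the summation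
  window.\<close>

lemma ar_blur_mirror:
  assumes "1 \<le> n1" "1 \<le> n2"
  shows "ar_blur n1 n2 q1 q2 (mirror_mask b1 b2 h) (mirror_image n1 n2 b1 b2 f) i1 i2 =
    ar_blur n1 n2 q1 q2 h f (mirror b1 (int n1 + 1) i1) (mirror b2 (int n2 + 1) i2)"
proof -
  have shift: "mirror b (int n + 1) (i - s) = mirror b (int n + 1) i - mirror b 0 s" for b n i s
    by (simp add: mirror_def)
  show ?thesis
    unfolding ar_blur_def ar_extend_mirror[OF assms] mirror_mask_def shift
    by (subst sum_mirror[symmetric, where b = b1], subst sum_mirror[symmetric, where b = b2]) simp
qed

section \<open>Reflection of the row-wise numbering\<close>

lemma mirror_index_less:
  assumes "k < n1 * n2"
  shows "mirror_index n1 n2 b1 b2 k < n1 * n2"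
proof -
  have "n2 > 0" using assms by (cases n2) auto
  then have "k div n2 < n1" "k mod n2 < n2"
    using assms by (auto simp: less_mult_imp_div_less)
  then have a: "mirror b1 (n1 - 1) (k div n2) < n1" and b: "mirror b2 (n2 - 1) (k mod n2) < n2"
    by (auto simp: mirror_def)
  have "mirror_index n1 n2 b1 b2 k < Suc (mirror b1 (n1 - 1) (k div n2)) * n2"
    using b by (simp add: mirror_index_def)
  also have "\<dots> \<le> n1 * n2" using a by (intro mult_le_mono1) simp
  finally show ?thesis .
qed

lemma mirror_index_div_mod:
  assumes "k < n1 * n2"
  shows "mirror_index n1 n2 b1 b2 k div n2 = mirror b1 (n1 - 1) (k div n2)"
    and "mirror_index n1 n2 b1 b2 k mod n2 = mirror b2 (n2 - 1) (k mod n2)"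
proof -
  have "n2 > 0" using assms by (cases n2) auto
  then have "k mod n2 < n2" by simp
  then have "mirror b2 (n2 - 1) (k mod n2) < n2" by (auto simp: mirror_def)
  then show "mirror_index n1 n2 b1 b2 k div n2 = mirror b1 (n1 - 1) (k div n2)"
    "mirror_index n1 n2 b1 b2 k mod n2 = mirror b2 (n2 - 1) (k mod n2)"
    by (simp_all add: mirror_index_def)
qed

text \<open>Translates 0-based reflection into 1-based reflection; \<open>n - Suc 0\<close> is the
  simp normal form of \<open>n - 1\<close>.\<close>

lemma int_mirror:
  assumes "a < n"
  shows "int (mirror b (n - Suc 0) a) + 1 = mirror b (int n + 1) (int a + 1)"
  using assms by (auto simp: mirror_def of_nat_diff)

lemma mirror_index_involutive:
  assumes "k < n1 * n2"
  shows "mirror_index n1 n2 b1 b2 (mirror_index n1 n2 b1 b2 k) = k"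
proof -
  have "n2 > 0" using assms by (cases n2) auto
  then have "k div n2 < n1" "k mod n2 < n2"
    using assms by (auto simp: less_mult_imp_div_less)
  \<comment> \<open>The bounds make the natural-number subtractions exact.\<close>
  then have "mirror b1 (n1 - 1) (mirror b1 (n1 - 1) (k div n2)) = k div n2"
    "mirror b2 (n2 - 1) (mirror b2 (n2 - 1) (k mod n2)) = k mod n2"
    by (auto simp: mirror_def)
  then show ?thesis
    using mirror_index_div_mod[OF assms]
    by (simp add: mirror_index_def[of _ _ _ _ "mirror_index n1 n2 b1 b2 k"])
qed

lemma unit_image_mirror_index:
  assumes "c < n1 * n2"
  shows "unit_image n2 (mirror_index n1 n2 b1 b2 c) = mirror_image n1 n2 b1 b2 (unit_image n2 c)"
proof (intro ext)
  fix i1 i2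
  have "n2 > 0" using assms by (cases n2) auto
  then have "c div n2 < n1" "c mod n2 < n2"
    using assms by (auto simp: less_mult_imp_div_less)
  then show "unit_image n2 (mirror_index n1 n2 b1 b2 c) i1 i2 =
      mirror_image n1 n2 b1 b2 (unit_image n2 c) i1 i2"
    by (auto simp: unit_image_def mirror_image_def mirror_index_div_mod[OF assms] int_mirror)
       (auto simp: mirror_def split: if_splits)
qed

section \<open>Reflection of Anti-Reflective matrices\<close>

lemma ar_matrix_carrier: "ar_matrix n1 n2 q1 q2 h \<in> carrier_mat (n1 * n2) (n1 * n2)"
  by (simp add: ar_matrix_def)

lemma ar_matrix_entry:
  assumes "r < n1 * n2" "c < n1 * n2"
  shows "ar_matrix n1 n2 q1 q2 h $$ (r, c) =
    ar_blur n1 n2 q1 q2 h (unit_image n2 c) (int (r div n2) + 1) (int (r mod n2) + 1)"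
  using assms by (simp add: ar_matrix_def vec_of_image_def)

text \<open>The mirrored column reflects the unit image and the mirrored row reflects the pixel;
  \<open>ar_blur_mirror\<close> reflects the pixel once more, which cancels.\<close>

lemma ar_matrix_mirror:
  assumes r: "r < n1 * n2" and c: "c < n1 * n2"
  shows "ar_matrix n1 n2 q1 q2 (mirror_mask b1 b2 h)
      $$ (mirror_index n1 n2 b1 b2 r, mirror_index n1 n2 b1 b2 c) =
    ar_matrix n1 n2 q1 q2 h $$ (r, c)"
proof -
  have pos: "1 \<le> n1" "1 \<le> n2" using r by (cases n1; cases n2; simp)+
  have rd: "r div n2 < n1" "r mod n2 < n2"
    using r pos by (auto simp: less_mult_imp_div_less)
  have inv: "mirror b (int n + 1) (mirror b (int n + 1) i) = i" for b n i
    by (simp add: mirror_def)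
  show ?thesis
    using rd
    by (simp add: ar_matrix_entry assms mirror_index_less unit_image_mirror_index
        mirror_index_div_mod[OF r] int_mirror ar_blur_mirror[OF pos] inv)
qed

lemma ar_blur_cong:
  assumes "\<And>s1 s2. \<lbrakk>s1 \<in> {- int q1..int q1}; s2 \<in> {- int q2..int q2}\<rbrakk> \<Longrightarrow> h s1 s2 = h' s1 s2"
  shows "ar_blur n1 n2 q1 q2 h = ar_blur n1 n2 q1 q2 h'"
  unfolding ar_blur_def by (intro ext sum.cong refl) (simp add: assms)

text \<open>The two masks may differ outside the window, so equality is shown only on it and
  transferred by \<open>ar_blur_cong\<close>.\<close>

lemma ar_matrix_mirror_strongly_symmetric:
  assumes "strongly_symmetric q1 q2 s"
  shows "ar_matrix n1 n2 q1 q2 (mirror_mask b1 b2 s) = ar_matrix n1 n2 q1 q2 s"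
proof -
  have "mirror_mask b1 b2 s s1 s2 = s s1 s2"
    if "s1 \<in> {- int q1..int q1}" "s2 \<in> {- int q2..int q2}" for s1 s2
  proof -
    have "mirror b1 0 s1 \<in> {- int q1..int q1}" "mirror b2 0 s2 \<in> {- int q2..int q2}"
      using that by (auto simp: mirror_def)
    then have "mirror_mask b1 b2 s s1 s2 = s \<bar>mirror b1 0 s1\<bar> \<bar>mirror b2 0 s2\<bar>"
      using assms unfolding strongly_symmetric_def mirror_mask_def by blast
    also have "\<dots> = s \<bar>s1\<bar> \<bar>s2\<bar>" by (simp add: mirror_def)
    also have "\<dots> = s s1 s2"
      using assms that unfolding strongly_symmetric_def by metis
    finally show ?thesis .
  qed
  then have "ar_blur n1 n2 q1 q2 (mirror_mask b1 b2 s) = ar_blur n1 n2 q1 q2 s"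
    by (rule ar_blur_cong)
  then show ?thesis by (simp add: ar_matrix_def)
qed

section \<open>Frobenius geometry\<close>

definition frobenius_inner :: "real mat \<Rightarrow> real mat \<Rightarrow> real" where
  "frobenius_inner A B = (\<Sum>i<dim_row A. \<Sum>j<dim_col A. A $$ (i, j) * B $$ (i, j))"

lemma frobenius_norm_power2: "(frobenius_norm A)\<^sup>2 = frobenius_inner A A"
  unfolding frobenius_norm_def frobenius_inner_def
  by (subst real_sqrt_pow2) (auto intro!: sum_nonneg simp: power2_eq_square)

lemma frobenius_inner_diff_left:
  assumes "A \<in> carrier_mat m n" "B \<in> carrier_mat m n" "C \<in> carrier_mat m n"
  shows "frobenius_inner (A - B) C = frobenius_inner A C - frobenius_inner B C"
  using assms by (simp add: frobenius_inner_def sum_subtractf left_diff_distrib)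

lemma frobenius_inner_commute:
  assumes "A \<in> carrier_mat m n" "B \<in> carrier_mat m n"
  shows "frobenius_inner A B = frobenius_inner B A"
  using assms by (simp add: frobenius_inner_def mult.commute)

lemma frobenius_inner_diff_right:
  assumes "A \<in> carrier_mat m n" "B \<in> carrier_mat m n" "C \<in> carrier_mat m n"
  shows "frobenius_inner A (B - C) = frobenius_inner A B - frobenius_inner A C"
  using assms by (simp add: frobenius_inner_def sum_subtractf right_diff_distrib)

lemma frobenius_norm_diff_eq_0_iff:
  assumes "A \<in> carrier_mat m n" "B \<in> carrier_mat m n"
  shows "frobenius_norm (A - B) = 0 \<longleftrightarrow> A = B"
  using assms
  by (auto simp: frobenius_norm_def sum_nonneg sum_nonneg_eq_0_iff intro!: eq_matI)

text \<open>The last two assumptions make \<open>A - S\<close> orthogonal to \<open>S\<close> and to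
  \<open>P\<close>, hence to \<open>S - P\<close>.\<close>

lemma frobenius_pythagoras:
  assumes "A \<in> carrier_mat m n" "S \<in> carrier_mat m n" "P \<in> carrier_mat m n"
    and "frobenius_inner S S = frobenius_inner A S"
    and "frobenius_inner S P = frobenius_inner A P"
  shows "(frobenius_norm (A - P))\<^sup>2 = (frobenius_norm (A - S))\<^sup>2 + (frobenius_norm (S - P))\<^sup>2"
proof -
  note [simp] = frobenius_inner_diff_left[of _ m n] frobenius_inner_diff_right[of _ m n]
    minus_carrier_mat
  show ?thesis
    using assms frobenius_inner_commute[of A m n P] frobenius_inner_commute[of A m n S]
      frobenius_inner_commute[of S m n P]
    by (simp add: frobenius_norm_power2)
qed

section \<open>Projection onto the algebra\<close>

lemma frobenius_inner_mirror_mask: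
  assumes "strongly_symmetric p1 p2 s"
  shows "frobenius_inner (ar_matrix n1 n2 q1 q2 (mirror_mask b1 b2 h)) (ar_matrix n1 n2 p1 p2 s) =
    frobenius_inner (ar_matrix n1 n2 q1 q2 h) (ar_matrix n1 n2 p1 p2 s)"
proof -
  let ?N = "n1 * n2"
  let ?\<rho> = "mirror_index n1 n2 b1 b2"
  let ?A = "ar_matrix n1 n2 q1 q2 (mirror_mask b1 b2 h)" and ?P = "ar_matrix n1 n2 p1 p2 s"
  \<comment> \<open>On valid indices the reflection is its own inverse.\<close>
  have perm: "(\<Sum>k<?N. g (?\<rho> k)) = (\<Sum>k<?N. g k)" for g :: "nat \<Rightarrow> real"
    by (rule sum.reindex_bij_witness[of _ ?\<rho> ?\<rho>])
       (auto simp: mirror_index_less mirror_index_involutive)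
  have P: "?P $$ (?\<rho> r, ?\<rho> c) = ?P $$ (r, c)" if "r < ?N" "c < ?N" for r c
    using ar_matrix_mirror[OF that, of p1 p2 b1 b2 s]
    by (simp add: ar_matrix_mirror_strongly_symmetric[OF assms])
  have "frobenius_inner ?A ?P = (\<Sum>r<?N. \<Sum>c<?N. ?A $$ (r, c) * ?P $$ (r, c))"
    by (simp add: frobenius_inner_def ar_matrix_def)
  also have "\<dots> = (\<Sum>r<?N. \<Sum>c<?N. ?A $$ (?\<rho> r, ?\<rho> c) * ?P $$ (?\<rho> r, ?\<rho> c))"
    unfolding perm[of "\<lambda>r. \<Sum>c<?N. ?A $$ (r, c) * ?P $$ (r, c)", symmetric]
    by (intro sum.cong refl perm[symmetric])
  also have "\<dots> = (\<Sum>r<?N. \<Sum>c<?N. ar_matrix n1 n2 q1 q2 h $$ (r, c) * ?P $$ (r, c))"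
    by (intro sum.cong refl) (simp add: ar_matrix_mirror P)
  also have "\<dots> = frobenius_inner (ar_matrix n1 n2 q1 q2 h) ?P"
    by (simp add: frobenius_inner_def ar_matrix_def)
  finally show ?thesis .
qed

text \<open>The four sign choices in \<open>symmetrized\<close> are the four pairs of
  booleans.\<close>

lemma ar_blur_symmetrized:
  "ar_blur n1 n2 q1 q2 (symmetrized h) f i1 i2 =
    (\<Sum>b1\<in>UNIV. \<Sum>b2\<in>UNIV. ar_blur n1 n2 q1 q2 (mirror_mask b1 b2 h) f i1 i2) / 4"
  unfolding UNIV_bool
  by (simp add: ar_blur_def mirror_mask_def mirror_def symmetrized_def
      sum_divide_distrib add_divide_distrib distrib_right sum.distrib)

lemma frobenius_inner_symmetrized:
  assumes "strongly_symmetric p1 p2 s"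
  shows "frobenius_inner (ar_matrix n1 n2 q1 q2 (symmetrized h)) (ar_matrix n1 n2 p1 p2 s) =
    frobenius_inner (ar_matrix n1 n2 q1 q2 h) (ar_matrix n1 n2 p1 p2 s)"
proof -
  let ?N = "n1 * n2" and ?P = "ar_matrix n1 n2 p1 p2 s"
  let ?A = "\<lambda>b1 b2. ar_matrix n1 n2 q1 q2 (mirror_mask b1 b2 h)"
  have "frobenius_inner (ar_matrix n1 n2 q1 q2 (symmetrized h)) ?P =
      (\<Sum>r<?N. \<Sum>c<?N. (\<Sum>b1\<in>UNIV. \<Sum>b2\<in>UNIV. ?A b1 b2 $$ (r, c)) / 4 * ?P $$ (r, c))"
    by (simp add: frobenius_inner_def ar_matrix_entry ar_blur_symmetrized
        carrier_matD[OF ar_matrix_carrier])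
  also have "\<dots> = (\<Sum>b1\<in>UNIV. \<Sum>b2\<in>UNIV. frobenius_inner (?A b1 b2) ?P) / 4"
    by (simp add: UNIV_bool frobenius_inner_def carrier_matD[OF ar_matrix_carrier] sum.distrib
        sum_divide_distrib add_divide_distrib distrib_right)
  also have "\<dots> = frobenius_inner (ar_matrix n1 n2 q1 q2 h) ?P"
    by (simp add: frobenius_inner_mirror_mask[OF assms] UNIV_bool)
  finally show ?thesis .
qed

theorem theorem4:
  fixes n1 n2 q1 q2 :: nat and h :: "int \<Rightarrow> int \<Rightarrow> real"
  assumes "3 \<le> n1" and "3 \<le> n2"
    and "q1 \<le> n1 - 3" and "q2 \<le> n2 - 3"
    and "is_psf q1 q2 h"
  shows "{P. is_arg_min (\<lambda>P. (frobenius_norm (ar_matrix n1 n2 q1 q2 h - P))\<^sup>2)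
               (\<lambda>P. P \<in> ar_algebra n1 n2) P} =
         {ar_matrix n1 n2 q1 q2 (symmetrized h)}"
proof -
  let ?A = "ar_matrix n1 n2 q1 q2 h" and ?S = "ar_matrix n1 n2 q1 q2 (symmetrized h)"
  have S: "?S \<in> ar_algebra n1 n2"
    using assms strongly_symmetric_symmetrized unfolding ar_algebra_def by blast
  have carrier: "P \<in> carrier_mat (n1 * n2) (n1 * n2)" if "P \<in> ar_algebra n1 n2" for P
    using that by (auto simp: ar_algebra_def intro: ar_matrix_carrier)
  have proj: "frobenius_inner ?S P = frobenius_inner ?A P" if "P \<in> ar_algebra n1 n2" for P
    using that frobenius_inner_symmetrized by (auto simp: ar_algebra_def)
  \<comment> \<open>\<open>proj\<close> enters twice, for \<open>P\<close> and for \<open>?S\<close>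
    itself, which also lies in the algebra.\<close>
  have pyth: "(frobenius_norm (?A - P))\<^sup>2 = (frobenius_norm (?A - ?S))\<^sup>2 + (frobenius_norm (?S - P))\<^sup>2"
    if "P \<in> ar_algebra n1 n2" for P
    using that S by (intro frobenius_pythagoras[OF ar_matrix_carrier] carrier proj)
  have "is_arg_min (\<lambda>P. (frobenius_norm (?A - P))\<^sup>2) (\<lambda>P. P \<in> ar_algebra n1 n2) P \<longleftrightarrow> P = ?S" for P
  proof
    assume min: "is_arg_min (\<lambda>P. (frobenius_norm (?A - P))\<^sup>2) (\<lambda>P. P \<in> ar_algebra n1 n2) P"
    then have P: "P \<in> ar_algebra n1 n2"
      and "\<not> (frobenius_norm (?A - ?S))\<^sup>2 < (frobenius_norm (?A - P))\<^sup>2"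
      using S by (auto simp: is_arg_min_def)
    \<comment> \<open>Minimality of \<open>P\<close> is tested against the competitor
      \<open>?S\<close>.\<close>
    then have "(frobenius_norm (?S - P))\<^sup>2 \<le> 0"
      using pyth[OF P] by simp
    then have "frobenius_norm (?S - P) = 0" by simp
    then show "P = ?S"
      using frobenius_norm_diff_eq_0_iff[OF carrier[OF S] carrier[OF P]] by simp
  next
    assume "P = ?S"
    moreover have "(frobenius_norm (?A - ?S))\<^sup>2 \<le> (frobenius_norm (?A - Q))\<^sup>2"
      if "Q \<in> ar_algebra n1 n2" for Q
      using pyth[OF that] by simp
    ultimately show "is_arg_min (\<lambda>P. (frobenius_norm (?A - P))\<^sup>2) (\<lambda>P. P \<in> ar_algebra n1 n2) P"
      using S by (simp add: is_arg_min_linorder)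
  qed
  then show ?thesis by blast
qed

end
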